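(* For any Banach lattice $E$, each of the sets $$\mathcal{C}_1=\{(x_j)_{j=1}^\infty \in E^{\mathbb{N}} : (x_j)_{j=1}^\infty \text{ is order bounded, disjoint and does not converge to } 0 \text{ in norm}\},$$ $$\mathcal{C}_2=\{(x_j)_{j=1}^\infty \in E^{\mathbb{N}} : (x_j)_{j=1}^\infty \text{ is norm bounded, disjoint and does not converge weakly to } 0\}$$ is empty or almost positive pointwise latticeable in $\ell_\infty(E)$.
   Context: Banach lattices are real. For a Banach lattice $E$, $\ell_\infty(E)$ is the Banach lattice of bounded $E$-valued sequences with the supremum norm and the pointwise ordering; $X^+$ denotes the positive cone of a Banach lattice $X$. A sequence $(x_j)_{j=1}^\infty$ in $E$ is disjoint if $|x_j| \wedge |x_k| = 0$ for $j \neq k$, and order bounded if there are $a,b \in E$ with $a \leq x_j \leq b$ for every $j$. A Banach sequence lattice is a linear subspace $X$ of $E^{\mathbb{N}}$, $E$ a Banach lattice, endowed with a complete norm that makes $X$ a Banach lattice with the pointwise ordering. A subset $B$ of a Banach sequence lattice $X$ with $B \cap X^+ \neq \emptyset$ is almost positive pointwise latticeable (in $X$) if for each positive sequence $\mathbf{x} \in B$ there exists a closed infinite dimensional sublattice of $X$ contained in $B \cup \{0\}$ and containing a subsequence of $\mathbf{x}$. *)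

theory Defs
  imports "HOL-Analysis.Analysis" "HOL-Library.Lattice_Algebras"
begin

section \<open>Banach lattices\<close>

class banach_lattice = banach + ordered_real_vector + lattice_ab_group_add_abs +
  assumes norm_mono_abs: "\<bar>x\<bar> \<le> \<bar>y\<bar> \<Longrightarrow> norm x \<le> norm y"

instance real :: banach_lattice
  by standard (auto simp: sup_real_def)

definition sublattice :: "'a::banach_lattice set \<Rightarrow> bool" where
  "sublattice Y \<longleftrightarrow> subspace Y \<and> (\<forall>x\<in>Y. \<forall>y\<in>Y. sup x y \<in> Y \<and> inf x y \<in> Y)"

definition infinite_dimensional :: "'a::real_vector set \<Rightarrow> bool" where
  "infinite_dimensional Y \<longleftrightarrow> \<not> (\<exists>B. finite B \<and> Y \<subseteq> span B)"

definition order_bounded_seq :: "(nat \<Rightarrow> 'a::order) \<Rightarrow> bool" where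
  "order_bounded_seq x \<longleftrightarrow> (\<exists>a b. \<forall>j. a \<le> x j \<and> x j \<le> b)"

definition disjoint_seq :: "(nat \<Rightarrow> 'a::banach_lattice) \<Rightarrow> bool" where
  "disjoint_seq x \<longleftrightarrow> (\<forall>j k. j \<noteq> k \<longrightarrow> inf \<bar>x j\<bar> \<bar>x k\<bar> = 0)"

definition weakly_tendsto :: "(nat \<Rightarrow> 'a::real_normed_vector) \<Rightarrow> 'a \<Rightarrow> bool" where
  "weakly_tendsto x l \<longleftrightarrow>
    (\<forall>\<phi> :: 'a \<Rightarrow> real. bounded_linear \<phi> \<longrightarrow> (\<lambda>j. \<phi> (x j)) \<longlonglongrightarrow> \<phi> l)"


section \<open>Banach sequence lattices\<close>

text \<open>
  A Banach sequence lattice is presented as a Banach lattice type \<open>'x\<close> together with the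
  inclusion \<open>seq\<close> of \<open>'x\<close> into the space of all sequences in \<open>'e\<close>. Injectivity of \<open>seq\<close> follows
  from \<open>less_eq_iff\<close>. No assumption is made that the lattice operations of \<open>'x\<close> are the
  coordinatewise ones; this only has to hold for the order.
\<close>

locale banach_sequence_lattice =
  fixes seq :: "'x::banach_lattice \<Rightarrow> nat \<Rightarrow> 'e::banach_lattice"
  assumes seq_add: "seq (x + y) j = seq x j + seq y j"
    and seq_scaleR: "seq (c *\<^sub>R x) j = c *\<^sub>R seq x j"
    and less_eq_iff: "x \<le> y \<longleftrightarrow> (\<forall>j. seq x j \<le> seq y j)"
begin

lemma inj_seq: "inj seq"
proof (rule injI)
  fix x y assume "seq x = seq y"
  then have "x \<le> y" "y \<le> x" by (simp_all add: less_eq_iff)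
  then show "x = y" by (rule order.antisym)
qed

definition almost_positive_pointwise_latticeable :: "(nat \<Rightarrow> 'e) set \<Rightarrow> bool" where
  "almost_positive_pointwise_latticeable B \<longleftrightarrow>
    B \<subseteq> range seq \<and> (\<exists>x\<ge>0. seq x \<in> B) \<and>
    (\<forall>x\<ge>0. seq x \<in> B \<longrightarrow>
      (\<exists>Y. closed Y \<and> sublattice Y \<and> infinite_dimensional Y \<and>
        seq ` Y \<subseteq> B \<union> {\<lambda>_. 0} \<and>
        (\<exists>r :: nat \<Rightarrow> nat. strict_mono r \<and> seq x \<circ> r \<in> seq ` Y)))"

end


section \<open>The Banach lattice of bounded sequences\<close>

text \<open>
  As \<open>nat\<close> is discrete, \<open>nat \<Rightarrow>\<^sub>C 'e\<close> consists of all bounded sequences in \<open>'e\<close>, with the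
  supremum norm (see \<open>range_apply_bcontfun_nat\<close> below). It becomes a Banach lattice under the
  pointwise order.
\<close>

lemma sup_diff_le:
  fixes x y x' y' :: "'a::lattice_ab_group_add_abs"
  shows "\<bar>sup x y - sup x' y'\<bar> \<le> \<bar>x - x'\<bar> + \<bar>y - y'\<bar>"
proof -
  have *: "sup a b - sup a' b' \<le> \<bar>a - a'\<bar> + \<bar>b - b'\<bar>" for a b a' b' :: 'a
  proof -
    have "a - a' \<le> \<bar>a - a'\<bar> + \<bar>b - b'\<bar>"
      by (rule order_trans[OF abs_ge_self]) simp
    then have "a \<le> a' + (\<bar>a - a'\<bar> + \<bar>b - b'\<bar>)" by (metis add.commute diff_le_eq)
    also have "\<dots> \<le> sup a' b' + (\<bar>a - a'\<bar> + \<bar>b - b'\<bar>)" by (simp add: add_right_mono)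
    finally have 1: "a \<le> sup a' b' + (\<bar>a - a'\<bar> + \<bar>b - b'\<bar>)" .
    have "b - b' \<le> \<bar>a - a'\<bar> + \<bar>b - b'\<bar>"
      by (rule order_trans[OF abs_ge_self]) simp
    then have "b \<le> b' + (\<bar>a - a'\<bar> + \<bar>b - b'\<bar>)" by (metis add.commute diff_le_eq)
    also have "\<dots> \<le> sup a' b' + (\<bar>a - a'\<bar> + \<bar>b - b'\<bar>)" by (simp add: add_right_mono)
    finally have 2: "b \<le> sup a' b' + (\<bar>a - a'\<bar> + \<bar>b - b'\<bar>)" .
    from 1 2 show ?thesis by (metis add.commute diff_le_eq le_supI)
  qed
  show ?thesis
  proof (rule abs_leI)
    show "- (sup x y - sup x' y') \<le> \<bar>x - x'\<bar> + \<bar>y - y'\<bar>"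
      using *[of x' y' x y] by (metis abs_minus_commute minus_diff_eq)
  qed (rule *)
qed

lemma norm_abs [simp]: "norm \<bar>x\<bar> = norm (x :: 'a::banach_lattice)"
  by (rule antisym) (auto intro!: norm_mono_abs)

lemma norm_sup_diff_le:
  fixes x y x' y' :: "'a::banach_lattice"
  shows "norm (sup x y - sup x' y') \<le> norm (x - x') + norm (y - y')"
proof -
  have "norm (sup x y - sup x' y') \<le> norm (\<bar>x - x'\<bar> + \<bar>y - y'\<bar>)"
    by (rule norm_mono_abs)
      (metis sup_diff_le abs_ge_self order_trans)
  also have "\<dots> \<le> norm (x - x') + norm (y - y')"
    by (metis norm_abs norm_triangle_ineq)
  finally show ?thesis .
qed

lemma tendsto_sup_banach_lattice:
  fixes f g :: "'b \<Rightarrow> 'a::banach_lattice"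
  assumes f: "(f \<longlongrightarrow> a) F" and g: "(g \<longlongrightarrow> b) F"
  shows "((\<lambda>x. sup (f x) (g x)) \<longlongrightarrow> sup a b) F"
proof -
  have "((\<lambda>x. norm (f x - a) + norm (g x - b)) \<longlongrightarrow> 0) F"
    using tendsto_add[OF tendsto_norm_zero[OF LIM_zero[OF f]] tendsto_norm_zero[OF LIM_zero[OF g]]]
    by simp
  then have "((\<lambda>x. sup (f x) (g x) - sup a b) \<longlongrightarrow> 0) F"
    by (rule Lim_null_comparison[rotated]) (intro always_eventually allI norm_sup_diff_le)
  then show ?thesis
    by (rule LIM_zero_cancel)
qed

lemma sup_cont:
  fixes f g :: "'b::topological_space \<Rightarrow> 'a::banach_lattice"
  assumes "f \<in> bcontfun" "g \<in> bcontfun"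
  shows "(\<lambda>x. sup (f x) (g x)) \<in> bcontfun"
proof -
  obtain A B where "norm (f x) \<le> A" "norm (g x) \<le> B" for x
    using assms by (auto simp: bcontfun_def bounded_iff)
  then have "norm (sup (f x) (g x)) \<le> A + B" for x
    using norm_sup_diff_le[of "f x" "g x" 0 0] by (smt (verit) diff_zero sup.idem)
  then show ?thesis
    using assms
    by (intro bcontfun_normI) (auto simp: bcontfun_def continuous_on_def intro!: tendsto_sup_banach_lattice)
qed

text \<open>The library has this instance only for functions on a metric space, which \<open>nat\<close> is not.\<close>

instance bcontfun :: (topological_space, complete_space) complete_space
proof
  fix F :: "nat \<Rightarrow> 'a \<Rightarrow>\<^sub>C 'b"
  assume F: "Cauchy F"
  have "uniformly_Cauchy_on UNIV (\<lambda>n. apply_bcontfun (F n))"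
    unfolding uniformly_Cauchy_on_def
    using metric_CauchyD[OF F] by (meson dist_fun_lt_imp_dist_val_lt)
  then obtain g where "uniform_limit UNIV (\<lambda>n. apply_bcontfun (F n)) g sequentially"
    using Cauchy_uniformly_convergent by (auto simp: uniformly_convergent_on_def)
  then show "convergent F"
    by (rule uniform_limit_bcontfunE) (auto intro: convergentI)
qed

unbundle bcontfun.lifting

instantiation bcontfun :: (topological_space, banach_lattice) banach_lattice
begin

lift_definition less_eq_bcontfun :: "('a \<Rightarrow>\<^sub>C 'b) \<Rightarrow> ('a \<Rightarrow>\<^sub>C 'b) \<Rightarrow> bool"
  is "\<lambda>f g. \<forall>x. f x \<le> g x" .

definition less_bcontfun :: "('a \<Rightarrow>\<^sub>C 'b) \<Rightarrow> ('a \<Rightarrow>\<^sub>C 'b) \<Rightarrow> bool"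
  where "less_bcontfun f g \<longleftrightarrow> f \<le> g \<and> \<not> g \<le> f"

lift_definition sup_bcontfun :: "('a \<Rightarrow>\<^sub>C 'b) \<Rightarrow> ('a \<Rightarrow>\<^sub>C 'b) \<Rightarrow> ('a \<Rightarrow>\<^sub>C 'b)"
  is "\<lambda>f g x. sup (f x) (g x)" by (rule sup_cont)

lift_definition inf_bcontfun :: "('a \<Rightarrow>\<^sub>C 'b) \<Rightarrow> ('a \<Rightarrow>\<^sub>C 'b) \<Rightarrow> ('a \<Rightarrow>\<^sub>C 'b)"
  is "\<lambda>f g x. inf (f x) (g x)"
  unfolding inf_eq_neg_sup by (intro uminus_cont sup_cont)

lift_definition abs_bcontfun :: "('a \<Rightarrow>\<^sub>C 'b) \<Rightarrow> ('a \<Rightarrow>\<^sub>C 'b)"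
  is "\<lambda>f x. \<bar>f x\<bar>"
  unfolding abs_lattice by (intro uminus_cont sup_cont)

instance
proof
  fix f g h :: "'a \<Rightarrow>\<^sub>C 'b" and a b :: real
  show "f < g \<longleftrightarrow> f \<le> g \<and> \<not> g \<le> f" by (rule less_bcontfun_def)
  show "f \<le> f" by transfer simp
  show "f \<le> g \<Longrightarrow> g \<le> h \<Longrightarrow> f \<le> h" by transfer (blast intro: order_trans)
  show "f \<le> g \<Longrightarrow> g \<le> f \<Longrightarrow> f = g" by transfer (auto intro!: ext order.antisym)
  show "inf f g \<le> f" "inf f g \<le> g" by (transfer, simp)+
  show "f \<le> g \<Longrightarrow> f \<le> h \<Longrightarrow> f \<le> inf g h" by transfer simp
  show "f \<le> sup f g" "g \<le> sup f g" by (transfer, simp)+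
  show "g \<le> f \<Longrightarrow> h \<le> f \<Longrightarrow> sup g h \<le> f" by transfer simp
  show "f \<le> g \<Longrightarrow> h + f \<le> h + g" by transfer simp
  show "f \<le> g \<Longrightarrow> 0 \<le> a \<Longrightarrow> a *\<^sub>R f \<le> a *\<^sub>R g" by transfer (simp add: scaleR_left_mono)
  show "a \<le> b \<Longrightarrow> 0 \<le> f \<Longrightarrow> a *\<^sub>R f \<le> b *\<^sub>R f" by transfer (simp add: scaleR_right_mono)
  show "\<bar>f\<bar> = sup f (- f)" by transfer (simp add: abs_lattice)
  show "norm f \<le> norm g" if "\<bar>f\<bar> \<le> \<bar>g\<bar>"
  proof (rule norm_bound)
    fix x
    from that have "\<bar>f x\<bar> \<le> \<bar>g x\<bar>" by transfer blast
    then have "norm (f x) \<le> norm (g x)" by (rule norm_mono_abs)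
    also have "\<dots> \<le> norm g" by (rule norm_bounded)
    finally show "norm (f x) \<le> norm g" .
  qed
qed

end

lemma range_apply_bcontfun_nat:
  "range (apply_bcontfun :: (nat \<Rightarrow>\<^sub>C 'e::metric_space) \<Rightarrow> nat \<Rightarrow> 'e) = {x. bounded (range x)}"
proof -
  have "{x. bounded (range x)} = (bcontfun :: (nat \<Rightarrow> 'e) set)"
    by (simp add: bcontfun_def)
  then show ?thesis
    by (metis type_definition.Rep_range type_definition_bcontfun)
qed

global_interpretation linf:
  banach_sequence_lattice "apply_bcontfun :: (nat \<Rightarrow>\<^sub>C 'e::banach_lattice) \<Rightarrow> nat \<Rightarrow> 'e"
  by standard (transfer, simp)+

end

theory Submission
  imports Defs
begin

text \<open>
  Both sets consist of bounded disjoint sequences along which an absolutely homogeneous functional \<open>p\<close>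
  dominated by the norm fails to tend to zero: \<open>p\<close> is the norm for the first set, and
  \<open>p = \<bar>\<phi>\<bar>\<close> with a suitable bounded functional \<open>\<phi>\<close>, depending on the sequence, for the second.

  Given a positive sequence \<open>x\<close> of this kind, choose a subsequence \<open>y\<close> with \<open>p (y j) \<ge> e > 0\<close>
  for all \<open>j\<close>. Partition the indices into infinitely many infinite blocks, and let \<open>Y\<close> consist of
  the bounded sequences \<open>(c j *\<^sub>R y j)\<close> whose coefficients \<open>c\<close> are constant on each block.
  Constant coefficients \<open>1\<close> give \<open>y\<close> itself. As every \<open>y j\<close> is positive, lattice operations in
  \<open>Y\<close> are lattice operations on the coefficients; as every \<open>y j\<close> is nonzero, limits in \<open>Y\<close> are
  limits of the coefficients, so \<open>Y\<close> is a closed sublattice (lemmas \<open>sublattice_block_multiples\<close>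
  and \<open>closed_block_multiples\<close>). The indicator functions of the
  blocks make it infinite dimensional (\<open>infinite_dimensional_block_multiples\<close>). A nonzero element
  of \<open>Y\<close> has a nonzero coefficient, which by construction recurs infinitely often; there
  \<open>p (c j *\<^sub>R y j) \<ge> \<bar>c j\<bar> * e\<close> stays away from zero. The
  inequality \<open>\<bar>c j\<bar> * e \<le> p (c j *\<^sub>R y j)\<close> also bounds the coefficients, so order boundedness
  passes from \<open>y\<close> to the elements of \<open>Y\<close> (\<open>block_sublattice_of_non_null\<close>).

  It remains to see that a nonempty set contains a positive sequence. In the first set, \<open>x\<close> may be
  replaced by \<open>\<bar>x\<bar>\<close>. In the second, the positive and negative parts of \<open>x\<close> cannot both be weakly
  null, since \<open>x\<close> is their difference.
\<close>

section \<open>Order and disjointness in Banach lattices\<close>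

lemma sup_scaleR_nonneg:
  fixes u :: "'a::banach_lattice"
  assumes "0 \<le> u"
  shows "sup (c *\<^sub>R u) (d *\<^sub>R u) = max c d *\<^sub>R u"
  using scaleR_right_mono[of c d u] scaleR_right_mono[of d c u] assms
  by (cases "c \<le> d") (simp_all add: max_def sup_absorb1 sup_absorb2)

lemma inf_scaleR_nonneg:
  fixes u :: "'a::banach_lattice"
  assumes "0 \<le> u"
  shows "inf (c *\<^sub>R u) (d *\<^sub>R u) = min c d *\<^sub>R u"
  using scaleR_right_mono[of c d u] scaleR_right_mono[of d c u] assms
  by (cases "c \<le> d") (simp_all add: min_def inf_absorb1 inf_absorb2)

lemma abs_scaleR_nonneg:
  fixes u :: "'a::banach_lattice"
  assumes "0 \<le> u"
  shows "\<bar>c *\<^sub>R u\<bar> = \<bar>c\<bar> *\<^sub>R u"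
proof -
  have "\<bar>c *\<^sub>R u\<bar> = sup (c *\<^sub>R u) ((- c) *\<^sub>R u)" by (simp add: abs_lattice)
  also have "\<dots> = max c (- c) *\<^sub>R u" by (rule sup_scaleR_nonneg[OF assms])
  also have "max c (- c) = \<bar>c\<bar>" by (simp add: max_def abs_if)
  finally show ?thesis .
qed

text \<open>A common scalar \<open>M\<close> for the two dominating elements suffices, because multiplication by a
  positive scalar is an order isomorphism: a lower bound of \<open>M *\<^sub>R u\<close> and \<open>M *\<^sub>R v\<close> is \<open>M\<close> times a
  lower bound of \<open>u\<close> and \<open>v\<close>.\<close>

lemma disjoint_seq_dominated:
  fixes y z :: "nat \<Rightarrow> 'a::banach_lattice"
  assumes disj: "disjoint_seq y" and dom: "\<And>j. \<bar>z j\<bar> \<le> m j *\<^sub>R \<bar>y j\<bar>"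
  shows "disjoint_seq z"
  unfolding disjoint_seq_def
proof (intro allI impI)
  fix j k :: nat assume "j \<noteq> k"
  then have disj_jk: "inf \<bar>y j\<bar> \<bar>y k\<bar> = 0"
    using disj by (simp add: disjoint_seq_def)
  define w where "w = inf \<bar>z j\<bar> \<bar>z k\<bar>"
  define M where "M = max 1 (max (m j) (m k))"
  have M: "M > 0" "m j \<le> M" "m k \<le> M" by (auto simp: M_def)
  have "\<bar>z j\<bar> \<le> M *\<^sub>R \<bar>y j\<bar>" "\<bar>z k\<bar> \<le> M *\<^sub>R \<bar>y k\<bar>"
    using dom M by (meson abs_ge_zero order_trans scaleR_right_mono)+
  then have "w \<le> M *\<^sub>R \<bar>y j\<bar>" "w \<le> M *\<^sub>R \<bar>y k\<bar>"
    unfolding w_def by (auto intro: le_infI1 le_infI2)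
  then have "inverse M *\<^sub>R w \<le> \<bar>y j\<bar>" "inverse M *\<^sub>R w \<le> \<bar>y k\<bar>"
    using scaleR_left_mono[of w _ "inverse M"] M by fastforce+
  then have "inverse M *\<^sub>R w \<le> 0"
    using disj_jk by (metis le_inf_iff)
  then have "w \<le> 0"
    using scaleR_left_mono[of "inverse M *\<^sub>R w" 0 M] M by simp
  moreover have "0 \<le> w" by (simp add: w_def)
  ultimately show "inf \<bar>z j\<bar> \<bar>z k\<bar> = 0" by (simp add: w_def order.antisym)
qed

lemma disjoint_seq_subseq:
  assumes "disjoint_seq x" "strict_mono r"
  shows "disjoint_seq (x \<circ> r)"
  using assms strict_mono_eq[of r] by (auto simp: disjoint_seq_def)

lemma abs_le_of_bounds:
  fixes v :: "'a::banach_lattice"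
  assumes "a \<le> v" "v \<le> b"
  shows "\<bar>v\<bar> \<le> \<bar>a\<bar> + \<bar>b\<bar>"
proof (rule abs_leI)
  have "v \<le> \<bar>b\<bar>" using assms(2) abs_ge_self order_trans by blast
  then show "v \<le> \<bar>a\<bar> + \<bar>b\<bar>" by (simp add: add_increasing)
  have "- v \<le> \<bar>a\<bar>" using assms(1) abs_ge_minus_self[of a] by (meson neg_le_iff_le order_trans)
  then show "- v \<le> \<bar>a\<bar> + \<bar>b\<bar>" by (simp add: add_increasing2)
qed

lemma order_bounded_seq_iff_abs:
  fixes x :: "nat \<Rightarrow> 'a::banach_lattice"
  shows "order_bounded_seq x \<longleftrightarrow> (\<exists>b. \<forall>j. \<bar>x j\<bar> \<le> b)"
proof
  assume "order_bounded_seq x"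
  then show "\<exists>b. \<forall>j. \<bar>x j\<bar> \<le> b"
    unfolding order_bounded_seq_def using abs_le_of_bounds by blast
next
  assume "\<exists>b. \<forall>j. \<bar>x j\<bar> \<le> b"
  then show "order_bounded_seq x"
    unfolding order_bounded_seq_def by (metis abs_le_D1 abs_le_D2 minus_le_iff)
qed

lemma order_bounded_seq_imp_bounded:
  fixes x :: "nat \<Rightarrow> 'a::banach_lattice"
  assumes "order_bounded_seq x"
  shows "bounded (range x)"
proof -
  obtain b where "\<bar>x j\<bar> \<le> b" for j
    using assms order_bounded_seq_iff_abs by blast
  then have "norm (x j) \<le> norm b" for j
    by (meson abs_ge_self norm_mono_abs order_trans)
  then show ?thesis by (auto simp: bounded_iff)
qed

lemma abs_sup_zero_le:
  fixes v :: "'a::banach_lattice"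
  shows "\<bar>sup v 0\<bar> \<le> \<bar>v\<bar>"
  by (metis abs_ge_self abs_ge_zero abs_of_nonneg le_supI sup.cobounded2)

lemma bounded_range_pos_part:
  fixes x :: "nat \<Rightarrow> 'a::banach_lattice"
  assumes "bounded (range x)"
  shows "bounded (range (\<lambda>j. sup (x j) 0))"
  using assms norm_mono_abs[OF abs_sup_zero_le]
  unfolding bounded_iff by (auto intro: order_trans)

section \<open>Sequences of multiples with blockwise constant coefficients\<close>

text \<open>The block of an index is the first component of the pair that it encodes, so that every
  block is infinite.\<close>

definition block :: "nat \<Rightarrow> nat" where
  "block j = fst (prod_decode j)"

lemma infinite_block: "infinite {j. block j = i}"
proof -
  have "range (\<lambda>n. prod_encode (i, n)) \<subseteq> {j. block j = i}"
    by (auto simp: block_def)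
  moreover have "inj (\<lambda>n. prod_encode (i, n))"
    by (rule injI) (metis prod_encode_inverse snd_conv)
  then have "infinite (range (\<lambda>n. prod_encode (i, n)))"
    using range_inj_infinite by blast
  ultimately show ?thesis by (metis finite_subset)
qed

lemma ex_block: "\<exists>j. block j = i"
  using infinite_block[of i] by (metis (mono_tags) Collect_empty_eq finite.emptyI)

definition block_multiples :: "(nat \<Rightarrow> 'e::banach_lattice) \<Rightarrow> (nat \<Rightarrow>\<^sub>C 'e) set" where
  "block_multiples y = {f. \<exists>a. \<forall>j. apply_bcontfun f j = a (block j) *\<^sub>R y j}"

lemma ex_bcontfun_eq:
  fixes x :: "nat \<Rightarrow> 'a::metric_space"
  assumes "bounded (range x)"
  obtains f where "apply_bcontfun f = x"
  using assms range_apply_bcontfun_nat by (metis mem_Collect_eq rangeE)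

lemma sublattice_block_multiples:
  fixes y :: "nat \<Rightarrow> 'e::banach_lattice"
  assumes pos: "\<And>j. 0 \<le> y j"
  shows "sublattice (block_multiples y)"
  unfolding sublattice_def
proof (intro conjI ballI)
  show "subspace (block_multiples y)"
  proof (rule subspaceI)
    show "0 \<in> block_multiples y"
      unfolding block_multiples_def by (auto intro!: exI[of _ "\<lambda>_. 0"])
  next
    fix f g assume "f \<in> block_multiples y" "g \<in> block_multiples y"
    then obtain a b where "\<forall>j. f j = a (block j) *\<^sub>R y j" "\<forall>j. g j = b (block j) *\<^sub>R y j"
      unfolding block_multiples_def by blast
    then show "f + g \<in> block_multiples y"
      unfolding block_multiples_def
      by (auto simp: scaleR_left_distrib intro!: exI[of _ "\<lambda>i. a i + b i"])
  next
    fix f c assume "f \<in> block_multiples y"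
    then obtain a where "\<forall>j. f j = a (block j) *\<^sub>R y j"
      unfolding block_multiples_def by blast
    then show "c *\<^sub>R f \<in> block_multiples y"
      unfolding block_multiples_def by (auto intro!: exI[of _ "\<lambda>i. c * a i"])
  qed
next
  fix f g assume "f \<in> block_multiples y" "g \<in> block_multiples y"
  then obtain a b where fg: "\<forall>j. f j = a (block j) *\<^sub>R y j" "\<forall>j. g j = b (block j) *\<^sub>R y j"
    unfolding block_multiples_def by blast
  then show "sup f g \<in> block_multiples y"
    unfolding block_multiples_def
    by (auto simp: sup_bcontfun.rep_eq sup_scaleR_nonneg[OF pos]
        intro!: exI[of _ "\<lambda>i. max (a i) (b i)"])
  from fg show "inf f g \<in> block_multiples y"
    unfolding block_multiples_def
    by (auto simp: inf_bcontfun.rep_eq inf_scaleR_nonneg[OF pos]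
        intro!: exI[of _ "\<lambda>i. min (a i) (b i)"])
qed

lemma convergent_scaleR_left:
  fixes v :: "'a::real_normed_vector"
  assumes "convergent (\<lambda>n. c n *\<^sub>R v)" "v \<noteq> 0"
  shows "convergent c"
proof -
  have "Cauchy (\<lambda>n. c n *\<^sub>R v)" using assms(1) by (rule convergent_Cauchy)
  have "Cauchy c"
  proof (rule metric_CauchyI)
    fix e :: real assume "e > 0"
    then have "e * norm v > 0" using assms(2) by simp
    then obtain N where "\<forall>m\<ge>N. \<forall>n\<ge>N. dist (c m *\<^sub>R v) (c n *\<^sub>R v) < e * norm v"
      using metric_CauchyD[OF \<open>Cauchy (\<lambda>n. c n *\<^sub>R v)\<close>] by blast
    moreover have "dist (c m *\<^sub>R v) (c n *\<^sub>R v) = dist (c m) (c n) * norm v" for m n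
      by (simp add: dist_norm flip: scaleR_left_diff_distrib)
    ultimately show "\<exists>N. \<forall>m\<ge>N. \<forall>n\<ge>N. dist (c m) (c n) < e"
      using assms(2) by auto
  qed
  then show ?thesis by (rule Cauchy_convergent)
qed

text \<open>Norm convergence implies convergence in each coordinate, and one coordinate in a block, where
  \<open>y\<close> is nonzero, already forces the coefficients of that block to converge.\<close>

lemma closed_block_multiples:
  fixes y :: "nat \<Rightarrow> 'e::banach_lattice"
  assumes nz: "\<And>j. y j \<noteq> 0"
  shows "closed (block_multiples y)"
  unfolding closed_sequential_limits
proof (intro allI impI, elim conjE)
  fix F :: "nat \<Rightarrow> nat \<Rightarrow>\<^sub>C 'e" and f
  assume mem: "\<forall>n. F n \<in> block_multiples y" and lim: "F \<longlonglongrightarrow> f"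
  from mem obtain a where a: "\<And>n j. F n j = a n (block j) *\<^sub>R y j"
    unfolding block_multiples_def by (simp, metis)
  have ptw: "(\<lambda>n. a n (block j) *\<^sub>R y j) \<longlonglongrightarrow> f j" for j
  proof -
    have "(\<lambda>n. dist (F n) f) \<longlonglongrightarrow> 0"
      using lim tendsto_dist_iff by blast
    then have "(\<lambda>n. dist (F n j) (f j)) \<longlonglongrightarrow> 0"
      by (rule tendsto_0_le[where K = 1]) (simp add: dist_bounded)
    then show ?thesis using tendsto_dist_iff a by fastforce
  qed
  have "\<exists>l. (\<lambda>n. a n i) \<longlonglongrightarrow> l" for i
  proof -
    obtain j where "block j = i" using ex_block by blast
    then show ?thesis
      using convergent_scaleR_left[of "\<lambda>n. a n i" "y j"] ptw[of j] nz[of j]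
      by (auto simp: convergent_def)
  qed
  then obtain l where l: "\<And>i. (\<lambda>n. a n i) \<longlonglongrightarrow> l i" by metis
  have "f j = l (block j) *\<^sub>R y j" for j
    using LIMSEQ_unique[OF ptw tendsto_scaleR[OF l tendsto_const]] .
  then show "f \<in> block_multiples y" unfolding block_multiples_def by blast
qed

text \<open>The restrictions of \<open>y\<close> to the single blocks are linearly independent: evaluation at an index
  of one block annihilates the restrictions to all other blocks.\<close>

lemma infinite_dimensional_block_multiples:
  fixes y :: "nat \<Rightarrow> 'e::banach_lattice"
  assumes nz: "\<And>j. y j \<noteq> 0" and bdd: "bounded (range y)"
  shows "infinite_dimensional (block_multiples y)"
proof -
  have "\<exists>f. \<forall>j. apply_bcontfun f j = (if block j = i then y j else 0)" for i
  proof -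
    have "range (\<lambda>j. if block j = i then y j else 0) \<subseteq> insert 0 (range y)" by auto
    then have "bounded (range (\<lambda>j. if block j = i then y j else 0))"
      by (rule bounded_subset[rotated]) (simp add: bdd)
    then obtain f where "apply_bcontfun f = (\<lambda>j. if block j = i then y j else 0)"
      by (rule ex_bcontfun_eq)
    then show ?thesis by (intro exI[of _ f]) simp
  qed
  then obtain e where e: "\<And>i j. apply_bcontfun (e i) j = (if block j = i then y j else 0)"
    by metis
  have "inj e"
  proof (rule injI)
    fix i k assume eq: "e i = e k"
    obtain j where "block j = i" using ex_block by blast
    then have "e i j \<noteq> 0" by (simp add: e nz)
    then have "e k j \<noteq> 0" by (simp add: eq)
    then show "i = k" using \<open>block j = i\<close> by (simp add: e split: if_splits)
  qed
  have "independent (range e)"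
    unfolding dependent_def
  proof (clarsimp)
    fix i assume span: "e i \<in> span (range e - {e i})"
    obtain j where j: "block j = i" using ex_block by blast
    have ann: "range e - {e i} \<subseteq> {f. apply_bcontfun f j = 0}"
    proof
      fix f assume "f \<in> range e - {e i}"
      then obtain k where "f = e k" "k \<noteq> i" by blast
      then show "f \<in> {f. apply_bcontfun f j = 0}" by (simp add: e j)
    qed
    have "subspace {f :: nat \<Rightarrow>\<^sub>C 'e. apply_bcontfun f j = 0}"
      by (auto intro!: subspaceI)
    then have "span (range e - {e i}) \<subseteq> {f. apply_bcontfun f j = 0}"
      using ann span_minimal by metis
    then have "apply_bcontfun (e i) j = 0" using span by (simp add: subset_iff)
    then show False using e j nz by simp
  qed
  moreover have "range e \<subseteq> block_multiples y"
  proof clarify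
    fix i
    have "\<forall>j. e i j = (if block j = i then 1 else 0) *\<^sub>R y j" by (simp add: e)
    then show "e i \<in> block_multiples y"
      unfolding block_multiples_def by (auto intro!: exI[of _ "\<lambda>k. if k = i then 1 else 0"])
  qed
  moreover have "infinite (range e)" using \<open>inj e\<close> range_inj_infinite by blast
  ultimately show ?thesis
    unfolding infinite_dimensional_def using independent_span_bound[of _ "range e"] by blast
qed

section \<open>Sublattices of sequences that are not null\<close>

text \<open>If \<open>p\<close> is only known not to tend to zero along \<open>x\<close>, blocks of indices may contain almost
  exclusively small values of \<open>p\<close>. Passing to a subsequence on which \<open>p\<close> is bounded below makes
  the same bound available on every block.\<close>

lemma block_sublattice_of_non_null:
  fixes x :: "nat \<Rightarrow> 'e::banach_lattice" and p :: "'e \<Rightarrow> real"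
  assumes pos: "\<And>j. 0 \<le> x j" and bdd: "bounded (range x)"
    and hom: "\<And>c v. p (c *\<^sub>R v) = \<bar>c\<bar> * p v"
    and dom: "\<And>v. p v \<le> K * norm v" and p_nonneg: "\<And>v. 0 \<le> p v"
    and non_null: "\<not> (\<lambda>j. p (x j)) \<longlonglongrightarrow> 0"
  obtains r Y where "strict_mono r" "closed Y" "sublattice Y" "infinite_dimensional Y"
    and "x \<circ> r \<in> apply_bcontfun ` Y"
    and "\<And>f. f \<in> Y \<Longrightarrow> f \<noteq> 0 \<Longrightarrow> \<exists>c. bounded (range c) \<and>
      (\<forall>j. apply_bcontfun f j = c j *\<^sub>R x (r j)) \<and> \<not> (\<lambda>j. p (apply_bcontfun f j)) \<longlonglongrightarrow> 0"
proof -
  obtain e where e: "e > 0" and freq: "\<forall>N. \<exists>n\<ge>N. p (x n) \<ge> e"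
    using non_null p_nonneg unfolding lim_sequentially
    by (simp add: dist_real_def) (metis not_less)
  define S where "S = {n. p (x n) \<ge> e}"
  have "infinite S"
    using freq unfolding S_def by (simp add: infinite_nat_iff_unbounded_le)
  define r where "r = enumerate S"
  have r: "strict_mono r" and r_S: "\<And>j. r j \<in> S"
    using \<open>infinite S\<close> by (simp_all add: r_def strict_mono_enumerate enumerate_in_set)
  define y where "y = x \<circ> r"
  have y_e: "p (y j) \<ge> e" for j using r_S[of j] by (simp add: y_def S_def)
  have nz: "y j \<noteq> 0" for j
    using y_e[of j] e hom[of 0 "y j"] by auto
  have y_pos: "0 \<le> y j" for j by (simp add: y_def pos)
  have y_bdd: "bounded (range y)"
    using bdd by (rule bounded_subset) (auto simp: y_def)
  show thesis
  proof
    show "strict_mono r" by (rule r)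
    show "closed (block_multiples y)" by (rule closed_block_multiples[OF nz])
    show "sublattice (block_multiples y)" by (rule sublattice_block_multiples[OF y_pos])
    show "infinite_dimensional (block_multiples y)"
      by (rule infinite_dimensional_block_multiples[OF nz y_bdd])
    obtain g where g: "apply_bcontfun g = y" using ex_bcontfun_eq[OF y_bdd] .
    then have "g \<in> block_multiples y"
      unfolding block_multiples_def by (auto intro!: exI[of _ "\<lambda>_. 1"])
    then show "x \<circ> r \<in> apply_bcontfun ` block_multiples y"
      using g by (metis image_eqI y_def)
  next
    fix f assume "f \<in> block_multiples y" "f \<noteq> 0"
    then obtain a where a: "\<And>j. apply_bcontfun f j = a (block j) *\<^sub>R y j"
      unfolding block_multiples_def by blast
    have lower: "\<bar>a (block j)\<bar> * e \<le> p (f j)" for j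
      using y_e[of j] by (simp add: a hom mult_left_mono)
    have "\<bar>a (block j)\<bar> \<le> \<bar>K\<bar> * norm f / e" for j
    proof -
      have "p (f j) \<le> \<bar>K\<bar> * norm f"
        using dom[of "f j"] norm_bounded[of f j]
        by (smt (verit) mult_left_mono mult_right_mono norm_ge_zero)
      then show ?thesis using lower[of j] e by (simp add: field_simps)
    qed
    then have "bounded (range (\<lambda>j. a (block j)))"
      by (auto simp: bounded_iff)
    moreover have "\<not> (\<lambda>j. p (f j)) \<longlonglongrightarrow> 0"
    proof
      assume null: "(\<lambda>j. p (f j)) \<longlonglongrightarrow> 0"
      have "\<exists>j. apply_bcontfun f j \<noteq> 0"
        using \<open>f \<noteq> 0\<close> by (metis bcontfun_eqI zero_bcontfun.rep_eq)
      then obtain i where "a i \<noteq> 0" using a by fastforce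
      then have "\<bar>a i\<bar> * e > 0" using e by simp
      then have "\<forall>\<^sub>F j in sequentially. p (f j) < \<bar>a i\<bar> * e"
        using null order_tendstoD(2) by blast
      then obtain N where "\<forall>j\<ge>N. p (f j) < \<bar>a i\<bar> * e"
        unfolding eventually_sequentially by blast
      moreover obtain j where "j \<ge> N" "block j = i"
        using infinite_block[of i] unfolding infinite_nat_iff_unbounded_le by blast
      ultimately show False using lower[of j] by fastforce
    qed
    ultimately show "\<exists>c. bounded (range c) \<and>
      (\<forall>j. apply_bcontfun f j = c j *\<^sub>R x (r j)) \<and> \<not> (\<lambda>j. p (apply_bcontfun f j)) \<longlonglongrightarrow> 0"
      using a y_def by auto
  qed
qed

lemma disjoint_seq_multiples:
  fixes x :: "nat \<Rightarrow> 'e::banach_lattice"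
  assumes "\<And>j. 0 \<le> x j" "disjoint_seq x" "strict_mono r" "\<And>j. z j = c j *\<^sub>R x (r j)"
  shows "disjoint_seq z"
proof (rule disjoint_seq_dominated)
  show "disjoint_seq (x \<circ> r)" using assms(2,3) by (rule disjoint_seq_subseq)
  show "\<bar>z j\<bar> \<le> \<bar>c j\<bar> *\<^sub>R \<bar>(x \<circ> r) j\<bar>" for j
    using assms(1,4) by (simp add: abs_scaleR_nonneg)
qed

lemma order_bounded_seq_multiples:
  fixes x :: "nat \<Rightarrow> 'e::banach_lattice"
  assumes pos: "\<And>j. 0 \<le> x j" and ob: "order_bounded_seq x" and c: "bounded (range c)"
    and z: "\<And>j. z j = c j *\<^sub>R x (r j)"
  shows "order_bounded_seq z"
proof -
  obtain b where b: "\<And>j. \<bar>x j\<bar> \<le> b"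
    using ob order_bounded_seq_iff_abs by blast
  obtain M where M: "\<And>j. \<bar>c j\<bar> \<le> M" using c by (auto simp: bounded_iff)
  then have "0 \<le> M" by (meson abs_ge_zero order_trans)
  have "\<bar>z j\<bar> \<le> M *\<^sub>R b" for j
  proof -
    have "\<bar>z j\<bar> = \<bar>c j\<bar> *\<^sub>R x (r j)" by (simp add: z abs_scaleR_nonneg pos)
    also have "\<dots> \<le> M *\<^sub>R x (r j)" by (rule scaleR_right_mono[OF M pos])
    also have "\<dots> \<le> M *\<^sub>R b" using b[of "r j"] pos[of "r j"] \<open>0 \<le> M\<close>
      by (simp add: scaleR_left_mono)
    finally show ?thesis .
  qed
  then show ?thesis using order_bounded_seq_iff_abs by blast
qed

lemma apply_bcontfun_nonneg: "0 \<le> x \<Longrightarrow> 0 \<le> apply_bcontfun x j"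
  for x :: "nat \<Rightarrow>\<^sub>C 'e::banach_lattice"
  using linf.less_eq_iff[of 0 x] by simp

lemma ex_nonneg_bcontfun_eq:
  fixes z :: "nat \<Rightarrow> 'e::banach_lattice"
  assumes "bounded (range z)" "\<And>j. 0 \<le> z j"
  obtains f where "0 \<le> f" "apply_bcontfun f = z"
  using ex_bcontfun_eq[OF assms(1)] assms(2) linf.less_eq_iff zero_bcontfun.rep_eq by metis

section \<open>The two sets of disjoint sequences\<close>

lemma latticeable_order_bounded_disjoint_not_null:
  fixes B :: "(nat \<Rightarrow> 'e::banach_lattice) set"
  assumes B: "B = {x. order_bounded_seq x \<and> disjoint_seq x \<and> \<not> x \<longlonglongrightarrow> 0}"
    and ne: "B \<noteq> {}"
  shows "linf.almost_positive_pointwise_latticeable B"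
  unfolding linf.almost_positive_pointwise_latticeable_def
proof (intro conjI allI impI)
  show "B \<subseteq> range apply_bcontfun"
    using B order_bounded_seq_imp_bounded by (auto simp: range_apply_bcontfun_nat)
next
  obtain x :: "nat \<Rightarrow> 'e" where x: "order_bounded_seq x" "disjoint_seq x" "\<not> x \<longlonglongrightarrow> 0"
    using ne B by blast
  have ob: "order_bounded_seq (\<lambda>j. \<bar>x j\<bar>)"
    using x(1) by (simp add: order_bounded_seq_iff_abs)
  have "disjoint_seq (\<lambda>j. \<bar>x j\<bar>)" using x(2) by (simp add: disjoint_seq_def)
  moreover have "\<not> (\<lambda>j. \<bar>x j\<bar>) \<longlonglongrightarrow> 0"
    using x(3) tendsto_norm_zero_iff[of x] tendsto_norm_zero_iff[of "\<lambda>j. \<bar>x j\<bar>"] by simp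
  moreover obtain f where "0 \<le> f" "apply_bcontfun f = (\<lambda>j. \<bar>x j\<bar>)"
    using ex_nonneg_bcontfun_eq[OF order_bounded_seq_imp_bounded[OF ob]] abs_ge_zero by blast
  ultimately show "\<exists>x\<ge>0. apply_bcontfun x \<in> B" using ob B by auto
next
  fix x :: "nat \<Rightarrow>\<^sub>C 'e" assume "0 \<le> x" and xB: "apply_bcontfun x \<in> B"
  have pos: "0 \<le> x j" for j by (rule apply_bcontfun_nonneg[OF \<open>0 \<le> x\<close>])
  have x: "order_bounded_seq x" "disjoint_seq x" "\<not> (\<lambda>j. norm (x j)) \<longlonglongrightarrow> 0"
    using xB B tendsto_norm_zero_iff by blast+
  obtain r Y where rY: "strict_mono r" "closed Y" "sublattice Y" "infinite_dimensional Y"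
    "apply_bcontfun x \<circ> r \<in> apply_bcontfun ` Y"
    and Y: "\<And>f. f \<in> Y \<Longrightarrow> f \<noteq> 0 \<Longrightarrow> \<exists>c. bounded (range c) \<and>
      (\<forall>j. apply_bcontfun f j = c j *\<^sub>R x (r j)) \<and> \<not> (\<lambda>j. norm (f j)) \<longlonglongrightarrow> 0"
  proof (rule block_sublattice_of_non_null[of "apply_bcontfun x" norm 1])
    show "bounded (range x)" by (rule order_bounded_seq_imp_bounded[OF x(1)])
  qed (use pos x(3) in auto)
  have "apply_bcontfun f \<in> B" if f: "f \<in> Y" "f \<noteq> 0" for f
  proof -
    obtain c where c: "bounded (range c)" "\<And>j. apply_bcontfun f j = c j *\<^sub>R x (r j)"
      "\<not> (\<lambda>j. norm (f j)) \<longlonglongrightarrow> 0"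
      using Y[OF f] by blast
    then show ?thesis
      using order_bounded_seq_multiples[OF pos x(1) c(1,2)]
        disjoint_seq_multiples[OF pos x(2) rY(1) c(2)] tendsto_norm_zero B by blast
  qed
  then have "apply_bcontfun ` Y \<subseteq> B \<union> {\<lambda>_. 0}"
    by (force intro: arg_cong[of _ 0 apply_bcontfun, unfolded zero_bcontfun.rep_eq])
  then show "\<exists>Y. closed Y \<and> sublattice Y \<and> infinite_dimensional Y \<and>
      apply_bcontfun ` Y \<subseteq> B \<union> {\<lambda>_. 0} \<and>
      (\<exists>r. strict_mono r \<and> apply_bcontfun x \<circ> r \<in> apply_bcontfun ` Y)"
    using rY by blast
qed

text \<open>Passing to \<open>\<bar>x\<bar>\<close> as for norm convergence would call for the modulus of a functional.
  Splitting \<open>x\<close> into its positive and negative parts only uses linearity.\<close>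

lemma pos_part_or_neg_part_not_weakly_null:
  fixes x :: "nat \<Rightarrow> 'e::banach_lattice"
  assumes "\<not> weakly_tendsto x 0"
  shows "\<not> weakly_tendsto (\<lambda>j. sup (x j) 0) 0 \<or> \<not> weakly_tendsto (\<lambda>j. sup (- x j) 0) 0"
proof (rule ccontr)
  assume "\<not> ?thesis"
  then have null: "weakly_tendsto (\<lambda>j. sup (x j) 0) 0" "weakly_tendsto (\<lambda>j. sup (- x j) 0) 0"
    by blast+
  have "weakly_tendsto x 0"
    unfolding weakly_tendsto_def
  proof (intro allI impI)
    fix \<phi> :: "'e \<Rightarrow> real" assume \<phi>: "bounded_linear \<phi>"
    then interpret bounded_linear \<phi> .
    have parts: "x j = sup (x j) 0 - sup (- x j) 0" for j
      by (metis diff_minus_eq_add neg_inf_eq_sup neg_equal_0_iff_equal pprt_def nprt_def prts)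
    have "(\<lambda>j. \<phi> (sup (x j) 0) - \<phi> (sup (- x j) 0)) \<longlonglongrightarrow> \<phi> 0 - \<phi> 0"
      using null \<phi> by (intro tendsto_diff) (auto simp: weakly_tendsto_def)
    moreover have "\<phi> (x j) = \<phi> (sup (x j) 0) - \<phi> (sup (- x j) 0)" for j
      using parts[of j] diff by metis
    ultimately show "(\<lambda>j. \<phi> (x j)) \<longlonglongrightarrow> \<phi> 0" by simp
  qed
  with assms show False by contradiction
qed

lemma latticeable_bounded_disjoint_not_weakly_null:
  fixes B :: "(nat \<Rightarrow> 'e::banach_lattice) set"
  assumes B: "B = {x. bounded (range x) \<and> disjoint_seq x \<and> \<not> weakly_tendsto x 0}"
    and ne: "B \<noteq> {}"
  shows "linf.almost_positive_pointwise_latticeable B"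
  unfolding linf.almost_positive_pointwise_latticeable_def
proof (intro conjI allI impI)
  show "B \<subseteq> range apply_bcontfun"
    using B by (auto simp: range_apply_bcontfun_nat)
next
  obtain x :: "nat \<Rightarrow> 'e" where x: "bounded (range x)" "disjoint_seq x" "\<not> weakly_tendsto x 0"
    using ne B by blast
  have pos_part: "bounded (range (\<lambda>j. sup (u j) 0)) \<and> disjoint_seq (\<lambda>j. sup (u j) 0)"
    if "bounded (range u)" "disjoint_seq u" for u :: "nat \<Rightarrow> 'e"
    using bounded_range_pos_part[OF that(1)]
      disjoint_seq_dominated[OF that(2), of "\<lambda>j. sup (u j) 0" "\<lambda>_. 1"] abs_sup_zero_le by auto
  have "bounded (range (\<lambda>j. - x j))" "disjoint_seq (\<lambda>j. - x j)"
    using x by (simp_all add: bounded_iff disjoint_seq_def)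
  then have "(\<lambda>j. sup (x j) 0) \<in> B \<or> (\<lambda>j. sup (- x j) 0) \<in> B"
    using pos_part[OF x(1,2)] pos_part pos_part_or_neg_part_not_weakly_null[OF x(3)] B by blast
  then obtain z where "z \<in> B" and pos: "\<And>j. 0 \<le> z j" by fastforce
  then have "bounded (range z)" using B by blast
  then obtain f where "0 \<le> f" "apply_bcontfun f = z"
    using ex_nonneg_bcontfun_eq pos by blast
  then show "\<exists>x\<ge>0. apply_bcontfun x \<in> B" using \<open>z \<in> B\<close> by blast
next
  fix x :: "nat \<Rightarrow>\<^sub>C 'e" assume "0 \<le> x" and xB: "apply_bcontfun x \<in> B"
  have pos: "0 \<le> x j" for j by (rule apply_bcontfun_nonneg[OF \<open>0 \<le> x\<close>])
  have x: "bounded (range x)" "disjoint_seq x" "\<not> weakly_tendsto x 0"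
    using xB B by blast+
  obtain \<phi> :: "'e \<Rightarrow> real" where \<phi>: "bounded_linear \<phi>" and lim: "\<not> (\<lambda>j. \<phi> (x j)) \<longlonglongrightarrow> \<phi> 0"
    using x(3) unfolding weakly_tendsto_def by blast
  interpret bounded_linear \<phi> by (rule \<phi>)
  obtain K where K: "\<And>v. norm (\<phi> v) \<le> norm v * K" using bounded by blast
  obtain r Y where rY: "strict_mono r" "closed Y" "sublattice Y" "infinite_dimensional Y"
    "apply_bcontfun x \<circ> r \<in> apply_bcontfun ` Y"
    and Y: "\<And>f. f \<in> Y \<Longrightarrow> f \<noteq> 0 \<Longrightarrow> \<exists>c. bounded (range c) \<and>
      (\<forall>j. apply_bcontfun f j = c j *\<^sub>R x (r j)) \<and> \<not> (\<lambda>j. \<bar>\<phi> (f j)\<bar>) \<longlonglongrightarrow> 0"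
  proof (rule block_sublattice_of_non_null[of "apply_bcontfun x" "\<lambda>v. \<bar>\<phi> v\<bar>" K])
    show "\<bar>\<phi> v\<bar> \<le> K * norm v" for v using K[of v] by (simp add: mult.commute)
    show "\<not> (\<lambda>j. \<bar>\<phi> (x j)\<bar>) \<longlonglongrightarrow> 0"
      using lim tendsto_rabs_zero_iff by auto
  qed (use pos x(1) in \<open>auto simp: scaleR abs_mult\<close>)
  have "apply_bcontfun f \<in> B" if f: "f \<in> Y" "f \<noteq> 0" for f
  proof -
    obtain c where c: "\<And>j. apply_bcontfun f j = c j *\<^sub>R x (r j)"
      "\<not> (\<lambda>j. \<bar>\<phi> (f j)\<bar>) \<longlonglongrightarrow> 0"
      using Y[OF f] by blast
    have "\<not> weakly_tendsto f 0"
      using c(2) \<phi> tendsto_rabs_zero unfolding weakly_tendsto_def by (metis zero)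
    moreover have "bounded (range f)"
      using range_apply_bcontfun_nat by blast
    ultimately show ?thesis
      using disjoint_seq_multiples[OF pos x(2) rY(1) c(1)] B by blast
  qed
  then have "apply_bcontfun ` Y \<subseteq> B \<union> {\<lambda>_. 0}"
    by (force intro: arg_cong[of _ 0 apply_bcontfun, unfolded zero_bcontfun.rep_eq])
  then show "\<exists>Y. closed Y \<and> sublattice Y \<and> infinite_dimensional Y \<and>
      apply_bcontfun ` Y \<subseteq> B \<union> {\<lambda>_. 0} \<and>
      (\<exists>r. strict_mono r \<and> apply_bcontfun x \<circ> r \<in> apply_bcontfun ` Y)"
    using rY by blast
qed

theorem corollary4p4:
  fixes C1 C2 :: "(nat \<Rightarrow> 'e::banach_lattice) set"
  assumes "C1 = {x. order_bounded_seq x \<and> disjoint_seq x \<and> \<not> x \<longlonglongrightarrow> 0}"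
    and "C2 = {x. bounded (range x) \<and> disjoint_seq x \<and> \<not> weakly_tendsto x 0}"
  shows "(C1 = {} \<or> linf.almost_positive_pointwise_latticeable C1) \<and>
         (C2 = {} \<or> linf.almost_positive_pointwise_latticeable C2)"
  using latticeable_order_bounded_disjoint_not_null[OF assms(1)]
    latticeable_bounded_disjoint_not_weakly_null[OF assms(2)] by blast

end
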